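(* Let $p\in (0,1)$, $q=1-p$, and let $u,d$ be real numbers with $0<d\le 1\le u$ and $u\neq d$. Then the variance of the net profit $T_n=T(n,u,d,p)$ after $n$ rounds satisfies $$\lim_{n\rightarrow \infty} \mathbb{V}(T_n)=\begin{cases} 0,&\text{if } u^pd^{q}\neq 1,\\ 1,&\text{if } u^pd^{q}=1. \end{cases}$$ Moreover, as $n\to\infty$, $$T_n\to \begin{cases} -1,&\text{if } u^pd^{q}< 1,\\ Z, & \text{if } u^p d^q =1,\\ 1,&\text{if } u^pd^{q}>1, \end{cases}$$ where the limit is understood in the sense of convergence in distribution, and $Z$ is a random variable with the two-point distribution $\mathbb{P}(Z=1) = \frac{1}{2} = \mathbb{P}(Z=-1)$.
   Context: For $n\in\mathbb{N}$, $n\ge 1$, let $X_n^{(p)}$ be a binomially distributed random variable with parameters $n$ and $p$ (the number of heads in $n$ independent coin tosses with heads probability $p$). Let $$\widetilde{k}_0(n,u,d)=\left\lfloor n \cdot \frac{\ln(1/d)}{\ln(u/d)} \right\rfloor\in\{0,\ldots,n\}.$$ The net profit after $n$ rounds (with stake $1$) is the random variable $$T(n,u,d,p)=\sum_{k=0}^{\widetilde{k}_0(n,u,d)}\mathbf{1}\{X_n^{(p)}=k\}\,(u^kd^{n-k}-1)+\mathbf{1}\{X_n^{(p)}\ge \widetilde{k}_0(n,u,d)+1\},$$ where $\mathbf{1}\{\cdot\}$ denotes the indicator function of an event. $\mathbb{V}$ denotes the variance. The limits $-1$ and $1$ in the distributional statement are the constant random variables. *)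

theory Defs
  imports "HOL-Probability.Probability"
begin

definition k0 :: "nat \<Rightarrow> real \<Rightarrow> real \<Rightarrow> nat" where
  "k0 n u d = nat \<lfloor>real n * (ln (1 / d) / ln (u / d))\<rfloor>"

text \<open>In the admissible parameter range the conversion to \<^typ>\<open>nat\<close> in \<^const>\<open>k0\<close> loses nothing,
  and no exponent \<open>n - k\<close> with \<open>k \<le> k0 n u d\<close> is truncated.\<close>

lemma k0_bounds:
  fixes u d :: real
  assumes "0 < d" "d \<le> 1" "1 \<le> u" "u \<noteq> d"
  shows int_k0: "int (k0 n u d) = \<lfloor>real n * (ln (1 / d) / ln (u / d))\<rfloor>"
    and k0_le: "k0 n u d \<le> n"
proof -
  have num: "0 \<le> ln (1 / d)" and den: "0 < ln (u / d)" and le: "ln (1 / d) \<le> ln (u / d)"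
    using assms by (auto intro!: ln_ge_zero ln_gt_zero ln_mono simp: divide_right_mono)
  have "0 \<le> ln (1 / d) / ln (u / d)" "ln (1 / d) / ln (u / d) \<le> 1"
    using num den le by auto
  then have nonneg: "0 \<le> real n * (ln (1 / d) / ln (u / d))"
    and le_n: "real n * (ln (1 / d) / ln (u / d)) \<le> real n"
    by (intro mult_nonneg_nonneg mult_left_le; simp)+
  show "int (k0 n u d) = \<lfloor>real n * (ln (1 / d) / ln (u / d))\<rfloor>"
    using nonneg by (simp add: k0_def)
  then show "k0 n u d \<le> n"
    using le_n by linarith
qed

definition net_profit :: "nat \<Rightarrow> real \<Rightarrow> real \<Rightarrow> ('a \<Rightarrow> nat) \<Rightarrow> 'a \<Rightarrow> real" where
  "net_profit n u d X \<omega> =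
     (\<Sum>k = 0..k0 n u d. indicator {\<omega>. X \<omega> = k} \<omega> * (u ^ k * d ^ (n - k) - 1))
     + indicator {\<omega>. X \<omega> \<ge> k0 n u d + 1} \<omega>"

text \<open>Each random variable of the sequence may live on its own probability space.\<close>

definition converges_in_distribution ::
  "(nat \<Rightarrow> 'a measure) \<Rightarrow> (nat \<Rightarrow> 'a \<Rightarrow> real) \<Rightarrow> 'b measure \<Rightarrow> ('b \<Rightarrow> real) \<Rightarrow> bool" where
  "converges_in_distribution M Y N L \<longleftrightarrow>
     weak_conv_m (\<lambda>n. distr (M n) borel (Y n)) (distr N borel L)"

end

theory Submission
  imports Defs "HOL-Real_Asymp.Real_Asymp"
begin

text \<open>
  Put \<open>c = ln (u / d)\<close> and \<open>r = ln (1 / d) / c\<close>. Since \<open>u ^ k * d ^ (n - k) = exp (c * (k - n * r))\<close>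
  and \<open>k0\<close> is the integer part of \<open>n * r\<close>, the net profit is a function of the single quantity
  \<open>Y = X - n * r\<close>: it equals \<open>exp (c * Y) - 1\<close> for \<open>Y \<le> 0\<close> and \<open>1\<close> for \<open>Y > 0\<close>
  (lemma \<open>net_profit_eq_gain\<close>). This function tends to \<open>-1\<close> at \<open>-\<infinity>\<close> and equals \<open>1\<close> on the
  positive axis, so only the way in which \<open>Y\<close> escapes to infinity matters.

  The mean of \<open>Y\<close> is \<open>n * (p - r)\<close> and its standard deviation has order \<open>sqrt n\<close>. By the theorem
  of de Moivre and Laplace the probability of \<open>Y \<le> K\<close> therefore tends, for every fixed \<open>K\<close>, to one
  number \<open>a\<close>, which is \<open>1\<close>, \<open>1 / 2\<close> or \<open>0\<close> according to whether \<open>p < r\<close>, \<open>p = r\<close> or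
  \<open>p > r\<close> (lemma \<open>binomial_cdf_limit\<close>). In other words \<open>Y\<close> goes to \<open>-\<infinity>\<close> with probability
  \<open>a\<close> and to \<open>\<infinity>\<close> with probability \<open>1 - a\<close>, and the net profit converges in distribution to
  the law with mass \<open>a\<close> at \<open>-1\<close> and \<open>1 - a\<close> at \<open>1\<close> (lemma \<open>gain_weak_conv\<close>). Because
  \<open>u powr p * d powr q = exp (c * (p - r))\<close>, these are the three cases of the theorem.

  The net profit has absolute value at most \<open>1\<close>, so weak convergence carries its first two moments
  along, and its variance tends to that of the limit law, which is \<open>4 * a * (1 - a)\<close>
  (lemma \<open>two_point_limit_variance\<close>).
\<close>

section \<open>The theorem of de Moivre and Laplace\<close>

lemma std_normal_singleton: "measure std_normal_distribution {x} = 0"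
  by (simp add: measure_def emeasure_density nn_integral_null_set null_sets_def flip: nn_integral_set_ennreal)

text \<open>The characteristic function \<open>exp (- t\<^sup>2 / 2)\<close> is even, so the distribution is symmetric; this is
  what makes the limit probability one half in the balanced case.\<close>

lemma std_normal_distribution_uminus:
  "distr std_normal_distribution borel uminus = std_normal_distribution"
proof (rule Levy_uniqueness)
  interpret N: real_distribution std_normal_distribution by (rule real_dist_normal_dist)
  show "real_distribution (distr std_normal_distribution borel uminus)"
    by (rule N.real_distribution_distr) simp
  show "real_distribution std_normal_distribution" by (rule real_dist_normal_dist)
  have "char (distr std_normal_distribution borel uminus) t = char std_normal_distribution (- t)" for t
    by (simp add: char_def integral_distr)
  then show "char (distr std_normal_distribution borel uminus) = char std_normal_distribution"
    by (simp add: fun_eq_iff char_std_normal_distribution)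
qed

lemma cdf_std_normal_0: "cdf std_normal_distribution 0 = 1 / 2"
proof -
  interpret N: real_distribution std_normal_distribution by (rule real_dist_normal_dist)
  have "cdf std_normal_distribution 0 = measure (distr std_normal_distribution borel uminus) {..0}"
    by (simp add: cdf_def std_normal_distribution_uminus)
  also have "\<dots> = N.prob {0..}"
    by (subst measure_distr) (auto simp: vimage_def atLeast_def)
  also have "\<dots> = N.prob ({0} \<union> {0<..})"
    by (rule arg_cong[where f = "N.prob"]) auto
  also have "\<dots> = N.prob {0<..}"
    by (subst N.finite_measure_Union) (auto simp: std_normal_singleton)
  also have "\<dots> = 1 - N.prob {..0}"
    by (subst N.prob_compl[symmetric]) (auto intro!: arg_cong[where f = "N.prob"])
  finally show ?thesis by (simp add: cdf_def)
qed

lemma char_binomial_pmf: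
  assumes "0 \<le> p" "p \<le> 1"
  shows "char (distr (binomial_pmf n p) borel real) t = (of_real (1 - p) + of_real p * iexp t) ^ n"
proof -
  have "char (distr (binomial_pmf n p) borel real) t
        = measure_pmf.expectation (binomial_pmf n p) (\<lambda>k. iexp (t * real k))"
    by (simp add: char_def integral_distr)
  also have "\<dots> = (\<Sum>k\<le>n. of_nat (n choose k) * (of_real p * iexp t) ^ k * of_real (1 - p) ^ (n - k))"
    using assms by (simp add: expectation_binomial_pmf' scaleR_conv_of_real power_mult_distrib
        exp_of_nat_mult[symmetric] mult_ac)
  also have "\<dots> = (of_real p * iexp t + of_real (1 - p)) ^ n"
    by (simp add: binomial_ring)
  finally show ?thesis by (simp add: add.commute)
qed

text \<open>The central limit theorem speaks about a sum of random variables on a fixed probability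
  space. It is applied to the coordinates of an infinite product of Bernoulli measures; the sum of the
  first \<open>n\<close> of them has the binomial law because the characteristic functions agree.\<close>

lemma de_Moivre_Laplace:
  assumes p: "0 < p" "p < 1"
  shows "weak_conv_m (\<lambda>n. distr (binomial_pmf n p) borel
            (\<lambda>k. (real k - real n * p) / sqrt (real n * (p * (1 - p))))) std_normal_distribution"
proof -
  define B where "B = PiM (UNIV :: nat set) (\<lambda>_. measure_pmf (bernoulli_pmf p))"
  define Y :: "nat \<Rightarrow> (nat \<Rightarrow> bool) \<Rightarrow> real" where "Y = (\<lambda>i \<omega>. of_bool (\<omega> i))"
  interpret P: product_prob_space "\<lambda>_. measure_pmf (bernoulli_pmf p)" "UNIV :: nat set" ..
  interpret B: prob_space B unfolding B_def by (rule P.P.prob_space_axioms)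
  have meas_coord [measurable]: "(\<lambda>\<omega>. \<omega> i) \<in> B \<rightarrow>\<^sub>M count_space UNIV" for i
    using measurable_component_singleton[of i UNIV "\<lambda>_. measure_pmf (bernoulli_pmf p)"]
    by (simp add: B_def)
  have coord: "distr B (bernoulli_pmf p) (\<lambda>\<omega>. \<omega> i) = bernoulli_pmf p" for i
    unfolding B_def by (rule distr_PiM_component) (auto intro: measure_pmf.prob_space_axioms)
  have "B.indep_vars (\<lambda>_. measure_pmf (bernoulli_pmf p)) (\<lambda>i \<omega>. \<omega> i) UNIV"
    by (subst B.indep_vars_iff_distr_eq_PiM')
       (use meas_coord coord in \<open>auto simp: B_def restrict_def distr_id2\<close>)
  then have indep: "B.indep_vars (\<lambda>_. borel) Y UNIV"
    unfolding Y_def by (rule B.indep_vars_compose2) auto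
  have distr_Y: "distr B borel (Y i) = distr (bernoulli_pmf p) borel of_bool" for i
  proof -
    have "distr B borel (Y i) = distr (distr B (bernoulli_pmf p) (\<lambda>\<omega>. \<omega> i)) borel of_bool"
      by (subst distr_distr) (use meas_coord in \<open>auto simp: Y_def comp_def\<close>)
    then show ?thesis by (simp only: coord)
  qed
  have rv_Y [measurable]: "Y i \<in> borel_measurable B" for i
    unfolding Y_def by measurable
  have ex: "integral\<^sup>L B (\<lambda>\<omega>. f (Y i \<omega>)) = f 1 * p + f 0 * (1 - p)"
    if "f \<in> borel_measurable borel" for f :: "real \<Rightarrow> real" and i
  proof -
    have "integral\<^sup>L B (\<lambda>\<omega>. f (Y i \<omega>)) = integral\<^sup>L (distr B borel (Y i)) f"
      using that by (simp add: integral_distr)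
    then show ?thesis using that p by (simp add: distr_Y integral_distr)
  qed
  have mean: "B.expectation (Y i) = p" for i
    using ex[of "\<lambda>x. x" i] by simp
  have clt: "weak_conv_m (\<lambda>n. distr B borel (\<lambda>\<omega>. (\<Sum>i<n. Y i \<omega> - p) / sqrt (real n * (sqrt (p * (1 - p)))\<^sup>2)))
               std_normal_distribution"
  proof (rule B.central_limit_theorem[OF indep mean _ _ _ distr_Y])
    show "0 < sqrt (p * (1 - p))" using p by simp
    show "integrable B (\<lambda>\<omega>. (Y i \<omega>)\<^sup>2)" for i
      by (rule B.integrable_const_bound[where B = 1]) (auto simp: Y_def)
    show "B.variance (Y i) = (sqrt (p * (1 - p)))\<^sup>2" for i
      using p ex[of "\<lambda>x. (x - p)\<^sup>2" i] by (simp add: mean) (simp add: power2_eq_square algebra_simps)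
  qed
  have sum: "distr B borel (\<lambda>\<omega>. \<Sum>i<n. Y i \<omega>) = distr (binomial_pmf n p) borel real" for n
  proof (rule Levy_uniqueness)
    show "real_distribution (distr B borel (\<lambda>\<omega>. \<Sum>i<n. Y i \<omega>))"
      by (rule B.real_distribution_distr) simp
    show "real_distribution (distr (binomial_pmf n p) borel real)"
      by (rule prob_space.real_distribution_distr[OF measure_pmf.prob_space_axioms]) simp
    have "char (distr (bernoulli_pmf p) borel of_bool) t = of_real (1 - p) + of_real p * iexp t" for t
      using p by (simp add: char_def integral_distr integral_measure_pmf[of UNIV] UNIV_bool scaleR_conv_of_real)
    then show "char (distr B borel (\<lambda>\<omega>. \<Sum>i<n. Y i \<omega>)) = char (distr (binomial_pmf n p) borel real)"
      using p by (intro ext, subst B.char_distr_sum[OF B.indep_vars_subset[OF indep]])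
         (auto simp: distr_Y char_binomial_pmf)
  qed
  have "distr B borel (\<lambda>\<omega>. (\<Sum>i<n. Y i \<omega> - p) / sqrt (real n * (sqrt (p * (1 - p)))\<^sup>2))
      = distr (binomial_pmf n p) borel
            (\<lambda>k. (real k - real n * p) / sqrt (real n * (p * (1 - p))))" for n
  proof -
    have "distr B borel (\<lambda>\<omega>. (\<Sum>i<n. Y i \<omega> - p) / sqrt (real n * (sqrt (p * (1 - p)))\<^sup>2))
        = distr (distr B borel (\<lambda>\<omega>. \<Sum>i<n. Y i \<omega>)) borel
            (\<lambda>x. (x - real n * p) / sqrt (real n * (p * (1 - p))))"
      using p by (subst distr_distr) (auto simp: comp_def sum_subtractf)
    also have "\<dots> = distr (binomial_pmf n p) borel
            (\<lambda>k. (real k - real n * p) / sqrt (real n * (p * (1 - p))))"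
      unfolding sum by (subst distr_distr) (auto simp: comp_def)
    finally show ?thesis .
  qed
  with clt show ?thesis by simp
qed

section \<open>Limits of binomial probabilities along a line\<close>

lemma linear_over_sqrt_at_top:
  fixes c s K :: real
  assumes "0 < c" "0 < s"
  shows "filterlim (\<lambda>n. (real n * c + K) / sqrt (real n * s)) at_top sequentially"
  using assms by real_asymp

lemma linear_over_sqrt_at_bot:
  fixes c s K :: real
  assumes "c < 0" "0 < s"
  shows "filterlim (\<lambda>n. (real n * c + K) / sqrt (real n * s)) at_bot sequentially"
proof -
  have "(\<lambda>n. - ((real n * c + K) / sqrt (real n * s)))
      = (\<lambda>n. (real n * (- c) + (- K)) / sqrt (real n * s))"
    by (auto simp: fun_eq_iff add_divide_distrib diff_divide_distrib)
  then show ?thesis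
    using linear_over_sqrt_at_top[of "- c" s "- K"] assms by (simp only: filterlim_uminus_at_bot)
qed

lemma const_over_sqrt_tendsto_0:
  fixes s K :: real
  assumes "0 < s"
  shows "(\<lambda>n. K / sqrt (real n * s)) \<longlonglongrightarrow> 0"
  using assms by real_asymp

text \<open>After standardisation the threshold \<open>n * r + K\<close> becomes \<open>t n\<close>, which is \<open>sqrt n * (r - p)\<close>
  up to a constant factor and a vanishing term and hence tends to \<open>\<infinity>\<close>, \<open>0\<close> or \<open>-\<infinity>\<close>; the
  limit is the value of the normal distribution function there. The threshold moves with \<open>n\<close>, so pointwise convergence of the distribution functions is not
  directly applicable: \<open>t n\<close> is compared with a fixed \<open>y\<close>, using monotonicity.\<close>

lemma binomial_cdf_limit:
  assumes p: "0 < p" "p < 1"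
  shows "(\<lambda>n. measure_pmf.prob (binomial_pmf n p) {k. real k \<le> real n * r + K})
           \<longlonglongrightarrow> (if p < r then 1 else if p = r then 1 / 2 else 0)"
proof -
  interpret N: real_distribution std_normal_distribution by (rule real_dist_normal_dist)
  define F where "F n = cdf (distr (binomial_pmf n p) borel
     (\<lambda>k. (real k - real n * p) / sqrt (real n * (p * (1 - p)))))" for n
  define t where "t n = (real n * (r - p) + K) / sqrt (real n * (p * (1 - p)))" for n
  have s: "0 < p * (1 - p)" using p by simp
  have "isCont (cdf std_normal_distribution) y" for y
    by (simp add: N.isCont_cdf std_normal_singleton)
  then have F: "(\<lambda>n. F n y) \<longlonglongrightarrow> cdf std_normal_distribution y" for y
    using de_Moivre_Laplace[OF p] by (simp add: weak_conv_m_def weak_conv_def F_def)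
  have mono: "F n x \<le> F n y" if "x \<le> y" for n x y
    unfolding F_def cdf_def using that
    by (intro finite_measure.finite_measure_mono measure_pmf.finite_measure_distr) auto
  have F_range: "0 \<le> F n y" "F n y \<le> 1" for n y
    using measure_pmf.prob_le_1 by (auto simp: F_def cdf_def measure_distr)
  have below: "eventually (\<lambda>n. F n (t n) < b) sequentially"
    if "eventually (\<lambda>n. t n \<le> y) sequentially" "cdf std_normal_distribution y < b" for y b
    using that(1) order_tendstoD(2)[OF F that(2)]
    by eventually_elim (use mono in \<open>fastforce intro: le_less_trans\<close>)
  have above: "eventually (\<lambda>n. b < F n (t n)) sequentially"
    if "eventually (\<lambda>n. y \<le> t n) sequentially" "b < cdf std_normal_distribution y" for y b
    using that(1) order_tendstoD(1)[OF F that(2)]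
    by eventually_elim (use mono in \<open>fastforce intro: less_le_trans\<close>)
  have "(\<lambda>n. F n (t n)) \<longlonglongrightarrow> (if p < r then 1 else if p = r then 1 / 2 else 0)"
  proof (cases p r rule: linorder_cases)
    case less
    have "filterlim t at_top sequentially"
      unfolding t_def using s less by (intro linear_over_sqrt_at_top) auto
    then have t: "eventually (\<lambda>n. y \<le> t n) sequentially" for y
      by (simp add: filterlim_at_top)
    have "(\<lambda>n. F n (t n)) \<longlonglongrightarrow> 1"
    proof (rule order_tendstoI)
      fix b :: real assume "b < 1"
      then have "eventually (\<lambda>y. b < cdf std_normal_distribution y) at_top"
        by (rule order_tendstoD(1)[OF N.cdf_lim_at_top_prob])
      then obtain y where "b < cdf std_normal_distribution y"
        using eventually_happens'[OF trivial_limit_at_top_linorder] by blast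
      then show "eventually (\<lambda>n. b < F n (t n)) sequentially"
        by (rule above[OF t])
    next
      fix b :: real assume "1 < b"
      then show "eventually (\<lambda>n. F n (t n) < b) sequentially"
        using F_range(2) by (intro always_eventually allI) (rule le_less_trans)
    qed
    then show ?thesis using less by simp
  next
    case greater
    have "filterlim t at_bot sequentially"
      unfolding t_def using s greater by (intro linear_over_sqrt_at_bot) auto
    then have t: "eventually (\<lambda>n. t n \<le> y) sequentially" for y
      by (simp add: filterlim_at_bot)
    have "(\<lambda>n. F n (t n)) \<longlonglongrightarrow> 0"
    proof (rule order_tendstoI)
      fix b :: real assume "0 < b"
      then have "eventually (\<lambda>y. cdf std_normal_distribution y < b) at_bot"
        by (rule order_tendstoD(2)[OF N.cdf_lim_at_bot])
      then obtain y where "cdf std_normal_distribution y < b"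
        using eventually_happens'[OF trivial_limit_at_bot_linorder] by blast
      then show "eventually (\<lambda>n. F n (t n) < b) sequentially"
        by (rule below[OF t])
    next
      fix b :: real assume "b < 0"
      then show "eventually (\<lambda>n. b < F n (t n)) sequentially"
        using F_range(1) by (intro always_eventually allI) (rule less_le_trans)
    qed
    then show ?thesis using greater by simp
  next
    case equal
    have t: "t \<longlonglongrightarrow> 0"
      using const_over_sqrt_tendsto_0[OF s, of K] equal unfolding t_def by simp
    have cont: "isCont (cdf std_normal_distribution) 0"
      by (simp add: N.isCont_cdf std_normal_singleton)
    have "(\<lambda>n. F n (t n)) \<longlonglongrightarrow> cdf std_normal_distribution 0"
    proof (rule order_tendstoI)
      fix b assume "b < cdf std_normal_distribution 0"
      then have "eventually (\<lambda>y. b < cdf std_normal_distribution y) (at_left 0)"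
        using cont by (intro order_tendstoD(1)) (auto simp: isCont_def filterlim_at_split)
      moreover have "eventually (\<lambda>y. y < 0) (at_left (0 :: real))"
        by (simp add: eventually_at_filter)
      ultimately have "eventually (\<lambda>y. b < cdf std_normal_distribution y \<and> y < 0) (at_left 0)"
        by (rule eventually_conj)
      then obtain y where "b < cdf std_normal_distribution y" "y < 0"
        using eventually_happens'[OF trivial_limit_at_left_real] by blast
      moreover have "eventually (\<lambda>n. y \<le> t n) sequentially"
        using order_tendstoD(1)[OF t \<open>y < 0\<close>] by eventually_elim simp
      ultimately show "eventually (\<lambda>n. b < F n (t n)) sequentially"
        by (intro above)
    next
      fix b assume "cdf std_normal_distribution 0 < b"
      then have "eventually (\<lambda>y. cdf std_normal_distribution y < b) (at_right 0)"
        using cont by (intro order_tendstoD(2)) (auto simp: isCont_def filterlim_at_split)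
      then have "eventually (\<lambda>y. cdf std_normal_distribution y < b \<and> 0 < y) (at_right 0)"
        using eventually_at_right_less by (rule eventually_conj)
      then obtain y where "cdf std_normal_distribution y < b" "0 < y"
        using eventually_happens'[OF trivial_limit_at_right_real] by blast
      moreover have "eventually (\<lambda>n. t n \<le> y) sequentially"
        using order_tendstoD(2)[OF t \<open>0 < y\<close>] by eventually_elim simp
      ultimately show "eventually (\<lambda>n. F n (t n) < b) sequentially"
        by (intro below)
    qed
    then show ?thesis using equal by (simp add: cdf_std_normal_0)
  qed
  moreover have "eventually (\<lambda>n. F n (t n) = measure_pmf.prob (binomial_pmf n p) {k. real k \<le> real n * r + K})
      sequentially"
    using eventually_gt_at_top[of 0]
  proof eventually_elim
    case (elim n)
    then have pos: "0 < sqrt (real n * (p * (1 - p)))" using s by simp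
    have "F n (t n) = measure_pmf.prob (binomial_pmf n p)
            {k. (real k - real n * p) / sqrt (real n * (p * (1 - p))) \<le> t n}"
      by (simp add: F_def cdf_def measure_distr vimage_def)
    also have "{k. (real k - real n * p) / sqrt (real n * (p * (1 - p))) \<le> t n} = {k. real k \<le> real n * r + K}"
      unfolding t_def divide_le_cancel using pos by (auto simp: right_diff_distrib)
    finally show ?case .
  qed
  ultimately show ?thesis by (rule Lim_transform_eventually)
qed

section \<open>The net profit as a function of the distance to the threshold\<close>

text \<open>The net profit when the number of heads exceeds the break-even line by \<open>x\<close>: on that line the
  capital is back at its initial value \<open>1\<close>, and each head above it multiplies the capital by the same
  factor \<open>exp c\<close>.\<close>

definition gain :: "real \<Rightarrow> real \<Rightarrow> real" where
  "gain c x = (if x \<le> 0 then exp (c * x) - 1 else 1)"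

lemma gain_bounds: assumes "0 < c" shows "-1 < gain c x" "gain c x \<le> 1"
proof -
  have "c * x \<le> 0" if "x \<le> 0" using assms that by (simp add: mult_le_0_iff)
  then show "-1 < gain c x" "gain c x \<le> 1"
    by (smt (verit) gain_def exp_gt_zero exp_le_one_iff)+
qed

text \<open>Strictly between the two limit values every sublevel set is a half-line with a finite end point,
  so its probability is a value of the distribution function of the argument.\<close>

lemma gain_le_iff:
  assumes "0 < c" "-1 < y" "y < 1"
  shows "gain c x \<le> y \<longleftrightarrow> x \<le> min 0 (ln (1 + y) / c)"
proof -
  have "exp (c * x) - 1 \<le> y \<longleftrightarrow> c * x \<le> ln (1 + y)"
    using ln_ge_iff[of "1 + y" "c * x"] assms by (simp add: algebra_simps)
  then show ?thesis using assms by (auto simp: gain_def pos_le_divide_eq mult.commute)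
qed

context
  fixes u d :: real
  assumes ud: "0 < d" "d \<le> 1" "1 \<le> u" "u \<noteq> d"
begin

lemma ln_ratio_pos: "0 < ln (u / d)"
  using ud by (auto intro!: ln_gt_zero)

lemma ln_ratio_times_break_even: "ln (u / d) * (ln (1 / d) / ln (u / d)) = - ln d"
  using ud ln_ratio_pos by (simp add: ln_div)

lemma net_profit_eq_gain:
  "net_profit n u d X \<omega> = gain (ln (u / d)) (real (X \<omega>) - real n * (ln (1 / d) / ln (u / d)))"
proof -
  let ?k = "X \<omega>" and ?r = "ln (1 / d) / ln (u / d)"
  have k0: "?k \<le> k0 n u d \<longleftrightarrow> real ?k \<le> real n * ?r"
  proof -
    have "?k \<le> k0 n u d \<longleftrightarrow> int ?k \<le> \<lfloor>real n * ?r\<rfloor>"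
      unfolding int_k0[OF ud, symmetric] by (rule of_nat_le_iff[symmetric])
    also have "\<dots> \<longleftrightarrow> real ?k \<le> real n * ?r" by (simp add: le_floor_iff)
    finally show ?thesis .
  qed
  have "net_profit n u d X \<omega> = (\<Sum>k = 0..k0 n u d. if ?k = k then u ^ k * d ^ (n - k) - 1 else 0)
     + (if k0 n u d < ?k then 1 else 0)"
    unfolding net_profit_def by (intro arg_cong2[where f = "(+)"] sum.cong) (auto simp: indicator_def)
  also have "\<dots> = (if ?k \<le> k0 n u d then u ^ ?k * d ^ (n - ?k) - 1 else 1)"
    by auto
  also have "\<dots> = gain (ln (u / d)) (real ?k - real n * ?r)"
  proof (cases "?k \<le> k0 n u d")
    case True
    then have le: "?k \<le> n" using k0_le[OF ud] by (rule order_trans)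
    have "ln (u / d) * (real ?k - real n * ?r) = real ?k * ln u + real (n - ?k) * ln d"
    proof -
      have "ln (u / d) * (real ?k - real n * ?r) = real ?k * ln (u / d) - real n * (ln (u / d) * ?r)"
        by (simp only: right_diff_distrib mult.left_commute mult.commute)
      then show ?thesis
        using ud le unfolding ln_ratio_times_break_even by (simp add: ln_div algebra_simps)
    qed
    then have "exp (ln (u / d) * (real ?k - real n * ?r)) = u ^ ?k * d ^ (n - ?k)"
      using ud by (simp add: exp_add exp_of_nat_mult)
    then show ?thesis using True k0 by (simp add: gain_def)
  qed (use k0 in \<open>auto simp: gain_def\<close>)
  finally show ?thesis .
qed

text \<open>The left-hand side is the geometric mean of the growth factor of one round; comparing it with \<open>1\<close>
  amounts to comparing the probability \<open>p\<close> with the break-even proportion of heads.\<close>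

lemma powr_growth_rate:
  "u powr p * d powr (1 - p) = exp (ln (u / d) * (p - ln (1 / d) / ln (u / d)))"
proof -
  have "ln (u / d) * (p - ln (1 / d) / ln (u / d)) = p * ln u + (1 - p) * ln d"
    using ud unfolding right_diff_distrib ln_ratio_times_break_even by (simp add: ln_div algebra_simps)
  then show ?thesis using ud by (simp add: powr_def exp_add)
qed

end

section \<open>Convergence to a two-point distribution\<close>

context prob_space
begin

lemma expectation_two_point:
  fixes L :: "'a \<Rightarrow> real" and f :: "real \<Rightarrow> real"
  assumes [measurable]: "L \<in> borel_measurable M" "f \<in> borel_measurable borel"
    and a: "\<P>(\<omega> in M. L \<omega> = -1) = a" "\<P>(\<omega> in M. L \<omega> = 1) = 1 - a"
  shows "expectation (\<lambda>\<omega>. f (L \<omega>)) = a * f (-1) + (1 - a) * f 1"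
proof -
  have "prob ({\<omega> \<in> space M. L \<omega> = -1} \<union> {\<omega> \<in> space M. L \<omega> = 1}) = 1"
    by (subst finite_measure_Union) (auto simp: a)
  then have "AE \<omega> in M. \<omega> \<in> {\<omega> \<in> space M. L \<omega> = -1} \<union> {\<omega> \<in> space M. L \<omega> = 1}"
    by (rule prob_eq_1[THEN iffD1, rotated]) measurable
  then have "AE \<omega> in M. f (L \<omega>) = f (-1) * indicator {\<omega> \<in> space M. L \<omega> = -1} \<omega>
                              + f 1 * indicator {\<omega> \<in> space M. L \<omega> = 1} \<omega>"
    by eventually_elim (auto simp: indicator_def)
  then have "expectation (\<lambda>\<omega>. f (L \<omega>))
      = expectation (\<lambda>\<omega>. f (-1) * indicator {\<omega> \<in> space M. L \<omega> = -1} \<omega>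
                        + f 1 * indicator {\<omega> \<in> space M. L \<omega> = 1} \<omega>)"
    by (intro integral_cong_AE) auto
  also have "\<dots> = a * f (-1) + (1 - a) * f 1"
    by (subst Bochner_Integration.integral_add) (auto simp: a Int_absorb2 emeasure_eq_measure)
  finally show ?thesis .
qed

lemma cdf_two_point:
  fixes L :: "'a \<Rightarrow> real"
  assumes [measurable]: "L \<in> borel_measurable M"
    and a: "\<P>(\<omega> in M. L \<omega> = -1) = a" "\<P>(\<omega> in M. L \<omega> = 1) = 1 - a"
  shows "cdf (distr M borel L) y = (if y < -1 then 0 else if y < 1 then a else 1)"
proof -
  have "cdf (distr M borel L) y = integral\<^sup>L (distr M borel L) (indicator {..y})"
    by (simp add: cdf_def)
  also have "\<dots> = expectation (\<lambda>\<omega>. indicator {..y} (L \<omega>))"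
    by (rule integral_distr) auto
  also have "\<dots> = a * indicator {..y} (-1) + (1 - a) * indicator {..y} 1"
    by (rule expectation_two_point[OF _ _ a]) auto
  finally show ?thesis by (auto simp: indicator_def)
qed

end

text \<open>The hypothesis \<open>lim\<close> says that the argument of the gain escapes to \<open>-\<infinity>\<close> with asymptotic
  probability \<open>a\<close> and to \<open>\<infinity>\<close> otherwise.\<close>

lemma gain_weak_conv:
  fixes L :: "'b \<Rightarrow> real"
  assumes c: "0 < c" and N: "prob_space N" "L \<in> borel_measurable N"
    and L: "\<P>(\<omega> in N. L \<omega> = -1) = a" "\<P>(\<omega> in N. L \<omega> = 1) = 1 - a"
    and Y: "\<And>n. real_distribution (\<mu> n)"
    and lim: "\<And>K. (\<lambda>n. measure (\<mu> n) {..K}) \<longlonglongrightarrow> a"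
  shows "weak_conv_m (\<lambda>n. distr (\<mu> n) borel (gain c)) (distr N borel L)"
  unfolding weak_conv_m_def weak_conv_def
proof (intro allI impI)
  interpret N: prob_space N by fact
  interpret D: real_distribution "distr N borel L" using N by simp
  have [measurable]: "gain c \<in> borel_measurable borel" unfolding gain_def by measurable
  fix y assume cont: "isCont (cdf (distr N borel L)) y"
  have cdf_gain: "cdf (distr (\<mu> n) borel (gain c)) y = measure (\<mu> n) {x. gain c x \<le> y}" for n
  proof -
    interpret Y: real_distribution "\<mu> n" by fact
    show ?thesis by (simp add: cdf_def measure_distr vimage_def)
  qed
  consider "y \<le> -1" | "-1 < y" "y < 1" | "1 \<le> y" by linarith
  then show "(\<lambda>n. cdf (distr (\<mu> n) borel (gain c)) y) \<longlonglongrightarrow> cdf (distr N borel L) y"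
  proof cases
    case 1
    \<comment> \<open>The gain never reaches \<open>-1\<close>, so the limit at \<open>y = -1\<close> is \<open>0\<close>; continuity of the limit
      distribution function there forces \<open>a = 0\<close>.\<close>
    have "{x. gain c x \<le> y} = {}" using gain_bounds(1)[OF c] 1 by (auto simp: not_le intro: le_less_trans)
    moreover have "cdf (distr N borel L) y = 0"
    proof (cases "y = -1")
      case True
      then have "measure (distr N borel L) {-1} = 0" using cont by (simp add: D.isCont_cdf)
      then have "a = 0" using N L by (simp add: measure_distr vimage_def Int_def conj_commute)
      then show ?thesis using True by (simp add: N.cdf_two_point[OF N(2) L])
    qed (use 1 in \<open>simp add: N.cdf_two_point[OF N(2) L]\<close>)
    ultimately show ?thesis by (simp add: cdf_gain)
  next
    case 2
    then have "{x. gain c x \<le> y} = {..min 0 (ln (1 + y) / c)}"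
      by (simp only: gain_le_iff[OF c 2] atMost_def)
    then show ?thesis using 2 lim[of "min 0 (ln (1 + y) / c)"]
      by (simp add: cdf_gain N.cdf_two_point[OF N(2) L])
  next
    case 3
    have "measure (\<mu> n) UNIV = 1" for n
    proof -
      interpret Y: real_distribution "\<mu> n" by fact
      show ?thesis using Y.prob_space by simp
    qed
    moreover have "{x. gain c x \<le> y} = UNIV" using gain_bounds(2)[OF c] 3 by (auto intro: order_trans)
    ultimately show ?thesis using 3 by (simp add: cdf_gain N.cdf_two_point[OF N(2) L])
  qed
qed

text \<open>Weak convergence yields convergence of integrals of bounded continuous functions only, and powers are
  unbounded; since all variables involved take values between \<open>-1\<close> and \<open>1\<close> almost surely, a power may be
  replaced by the same power of the argument clipped to that interval.\<close>

lemma two_point_limit_variance: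
  fixes L :: "'b \<Rightarrow> real" and h :: "nat \<Rightarrow> 'c \<Rightarrow> real"
  assumes N: "prob_space N" "L \<in> borel_measurable N"
    and L: "\<P>(\<omega> in N. L \<omega> = -1) = a" "\<P>(\<omega> in N. L \<omega> = 1) = 1 - a"
    and M: "\<And>n. prob_space (M n)" and h [measurable]: "\<And>n. h n \<in> borel_measurable (M n)"
    and bound: "\<And>n \<omega>. \<bar>h n \<omega>\<bar> \<le> 1"
    and conv: "weak_conv_m (\<lambda>n. distr (M n) borel (h n)) (distr N borel L)"
  shows "(\<lambda>n. prob_space.variance (M n) (h n)) \<longlonglongrightarrow> 4 * a * (1 - a)"
proof -
  interpret N: prob_space N by fact
  note N(2) [measurable]
  define clip where "clip x = max (-1) (min 1 x)" for x :: real
  have cont: "isCont clip x" for x unfolding clip_def by (intro continuous_intros)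
  have [measurable]: "clip \<in> borel_measurable borel" unfolding clip_def by measurable
  have clip_bound: "\<bar>clip x\<bar> \<le> 1" for x by (auto simp: clip_def)
  have moment: "(\<lambda>n. integral\<^sup>L (M n) (\<lambda>\<omega>. h n \<omega> ^ j)) \<longlonglongrightarrow> a * (-1) ^ j + (1 - a)" for j
  proof -
    have "(\<lambda>n. integral\<^sup>L (distr (M n) borel (h n)) (\<lambda>x. clip x ^ j)) \<longlonglongrightarrow> integral\<^sup>L (distr N borel L) (\<lambda>x. clip x ^ j)"
    proof (rule weak_conv_imp_integral_bdd_continuous_conv)
      show "real_distribution (distr (M n) borel (h n))" for n
        using M h by (rule prob_space.real_distribution_distr)
      show "real_distribution (distr N borel L)" by simp
      show "isCont (\<lambda>x. clip x ^ j) x" for x using cont by (intro continuous_intros)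
      show "norm (clip x ^ j) \<le> 1" for x
        using clip_bound by (simp add: power_abs power_le_one)
    qed fact
    moreover have "integral\<^sup>L (distr (M n) borel (h n)) (\<lambda>x. clip x ^ j) = integral\<^sup>L (M n) (\<lambda>\<omega>. h n \<omega> ^ j)" for n
    proof -
      have "clip (h n \<omega>) = h n \<omega>" for \<omega> using bound[of n \<omega>] by (auto simp: clip_def abs_le_iff)
      then show ?thesis by (simp add: integral_distr)
    qed
    moreover have "integral\<^sup>L (distr N borel L) (\<lambda>x. clip x ^ j) = a * (-1) ^ j + (1 - a)"
      using N.expectation_two_point[OF _ _ L, of "\<lambda>x. clip x ^ j"]
      by (simp add: integral_distr) (simp add: clip_def)
    ultimately show ?thesis by simp
  qed
  have "prob_space.variance (M n) (h n)
      = integral\<^sup>L (M n) (\<lambda>\<omega>. h n \<omega> ^ 2) - (integral\<^sup>L (M n) (\<lambda>\<omega>. h n \<omega> ^ 1))\<^sup>2" for n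
  proof -
    interpret M: prob_space "M n" by (rule M)
    have "integrable (M n) (h n)" using bound by (intro M.integrable_const_bound[where B = 1]) auto
    moreover have "integrable (M n) (\<lambda>\<omega>. (h n \<omega>)\<^sup>2)"
      using bound by (intro M.integrable_const_bound[where B = 1]) (auto simp: abs_square_le_1)
    ultimately show ?thesis by (simp add: M.variance_eq)
  qed
  moreover have "(\<lambda>n. integral\<^sup>L (M n) (\<lambda>\<omega>. h n \<omega> ^ 2) - (integral\<^sup>L (M n) (\<lambda>\<omega>. h n \<omega> ^ 1))\<^sup>2)
     \<longlonglongrightarrow> (a * (-1) ^ 2 + (1 - a)) - (a * (-1) ^ 1 + (1 - a))\<^sup>2"
    by (intro tendsto_intros moment)
  moreover have "(a * (-1) ^ 2 + (1 - a)) - (a * (-1) ^ 1 + (1 - a))\<^sup>2 = 4 * a * (1 - a)"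
    by (simp add: power2_eq_square algebra_simps)
  ultimately show ?thesis by (simp only:)
qed

section \<open>Variance and distributional limit of the net profit\<close>

theorem theorem4p10:
  fixes p q u d :: real
    and M :: "nat \<Rightarrow> 'a measure" and X :: "nat \<Rightarrow> 'a \<Rightarrow> nat"
    and N :: "'b measure" and Z :: "'b \<Rightarrow> real"
  assumes "0 < p" "p < 1" "q = 1 - p"
    and "0 < d" "d \<le> 1" "1 \<le> u" "u \<noteq> d"
    and "\<And>n. n \<ge> 1 \<Longrightarrow> prob_space (M n)"
    and "\<And>n. n \<ge> 1 \<Longrightarrow> X n \<in> measurable (M n) (count_space UNIV)"
    and "\<And>n. n \<ge> 1 \<Longrightarrow>
           distr (M n) (count_space UNIV) (X n) = measure_pmf (binomial_pmf n p)"
    and "prob_space N" and "Z \<in> borel_measurable N"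
    and "\<P>(\<omega> in N. Z \<omega> = 1) = 1 / 2" and "\<P>(\<omega> in N. Z \<omega> = -1) = 1 / 2"
  shows "((\<lambda>n. prob_space.variance (M n) (net_profit n u d (X n)))
            \<longlonglongrightarrow> (if u powr p * d powr q \<noteq> 1 then 0 else 1))
       \<and> converges_in_distribution M (\<lambda>n. net_profit n u d (X n)) N
            (if u powr p * d powr q < 1 then (\<lambda>_. -1)
             else if u powr p * d powr q = 1 then Z
             else (\<lambda>_. 1))"
proof -
  interpret N: prob_space N by fact
  note Z [measurable] = \<open>Z \<in> borel_measurable N\<close>
  note ud = \<open>0 < d\<close> \<open>d \<le> 1\<close> \<open>1 \<le> u\<close> \<open>u \<noteq> d\<close>
  define c where "c = ln (u / d)"
  define r where "r = ln (1 / d) / c"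
  define w where "w = u powr p * d powr q"
  define L where "L = (if w < 1 then (\<lambda>_. -1) else if w = 1 then Z else (\<lambda>_. 1))"
  define a :: real where "a = (if w < 1 then 1 else if w = 1 then 1 / 2 else 0)"
  define h where "h n k = gain c (real k - real n * r)" for n k
  have c: "0 < c" unfolding c_def by (rule ln_ratio_pos[OF ud])
  have w: "w = exp (c * (p - r))"
    using powr_growth_rate[OF ud, of p] \<open>q = 1 - p\<close> by (simp add: w_def c_def r_def)
  have a: "a = (if p < r then 1 else if p = r then 1 / 2 else 0)"
    using c by (auto simp: a_def w mult_less_0_iff)
  have L_meas: "L \<in> borel_measurable N" by (simp add: L_def)
  have L_prob: "\<P>(\<omega> in N. L \<omega> = -1) = a" "\<P>(\<omega> in N. L \<omega> = 1) = 1 - a"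
    using assms N.prob_space by (auto simp: L_def a_def)
  have profit: "net_profit n u d (X n) = (\<lambda>\<omega>. h n (X n \<omega>))" for n
    by (simp add: fun_eq_iff h_def c_def r_def net_profit_eq_gain[OF ud])

  have gain_meas [measurable]: "gain c \<in> borel_measurable borel"
    unfolding gain_def by measurable
  have shift: "distr (distr (binomial_pmf n p) borel (\<lambda>k. real k - real n * r)) borel (gain c)
      = distr (binomial_pmf n p) borel (h n)" for n
    by (subst distr_distr) (auto simp: comp_def h_def[abs_def])
  have "(\<lambda>n. measure (distr (binomial_pmf n p) borel (\<lambda>k. real k - real n * r)) {..K}) \<longlonglongrightarrow> a" for K
    using binomial_cdf_limit[of p r K] assms(1,2)
    by (simp add: a measure_distr vimage_def algebra_simps)
  then have conv: "weak_conv_m (\<lambda>n. distr (binomial_pmf n p) borel (h n)) (distr N borel L)"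
    unfolding shift[symmetric]
    by (intro gain_weak_conv[OF c N.prob_space_axioms L_meas L_prob]
          prob_space.real_distribution_distr[OF measure_pmf.prob_space_axioms]) auto
  have var: "(\<lambda>n. measure_pmf.variance (binomial_pmf n p) (h n)) \<longlonglongrightarrow> 4 * a * (1 - a)"
    using gain_bounds[OF c]
    by (intro two_point_limit_variance[OF N.prob_space_axioms L_meas L_prob _ _ _ conv]
          measure_pmf.prob_space_axioms) (auto simp: h_def abs_le_iff less_imp_le minus_le_iff)

  \<comment> \<open>Variance and law depend only on the distribution of \<open>X n\<close>. The spaces are tied to the
    binomial law from \<open>n = 1\<close> on, whence the transfer up to finitely many indices.\<close>
  have law: "distr (M n) borel (net_profit n u d (X n)) = distr (binomial_pmf n p) borel (h n)"
    if "n \<ge> 1" for n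
    using assms(9)[OF that]
    by (subst assms(10)[OF that, symmetric], subst distr_distr) (auto simp: profit comp_def)
  have ex: "integral\<^sup>L (M n) (\<lambda>\<omega>. f (X n \<omega>)) = integral\<^sup>L (binomial_pmf n p) f"
    if "n \<ge> 1" for n and f :: "nat \<Rightarrow> real"
    using assms(9)[OF that]
    by (subst assms(10)[OF that, symmetric], subst integral_distr) auto
  have "eventually (\<lambda>n. measure_pmf.variance (binomial_pmf n p) (h n)
           = prob_space.variance (M n) (net_profit n u d (X n))) sequentially"
    using eventually_ge_at_top[of 1]
  proof eventually_elim
    case (elim n)
    then show ?case
      using ex[OF elim, of "h n"] ex[OF elim, of "\<lambda>k. (h n k - integral\<^sup>L (binomial_pmf n p) (h n))\<^sup>2"]
      by (simp add: profit)
  qed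
  then have "(\<lambda>n. prob_space.variance (M n) (net_profit n u d (X n))) \<longlonglongrightarrow> 4 * a * (1 - a)"
    by (rule Lim_transform_eventually[OF var])
  moreover have "4 * a * (1 - a) = (if w \<noteq> 1 then 0 else 1)" by (simp add: a_def)
  moreover have "converges_in_distribution M (\<lambda>n. net_profit n u d (X n)) N L"
    unfolding converges_in_distribution_def weak_conv_m_def weak_conv_def
  proof (intro allI impI)
    fix y assume "isCont (cdf (distr N borel L)) y"
    with conv have "(\<lambda>n. cdf (distr (binomial_pmf n p) borel (h n)) y) \<longlonglongrightarrow> cdf (distr N borel L) y"
      by (simp add: weak_conv_m_def weak_conv_def)
    then show "(\<lambda>n. cdf (distr (M n) borel (net_profit n u d (X n))) y) \<longlonglongrightarrow> cdf (distr N borel L) y"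
      by (rule Lim_transform_eventually)
         (use eventually_ge_at_top[of 1] in eventually_elim, simp add: law)
  qed
  ultimately show ?thesis unfolding w_def[symmetric] L_def[symmetric] by simp
qed

end
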